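(* Given two third-order tensors $\mathscr{T}\in\mathbb{R}^{n_1\times l\times n_3}$ and $\mathscr{S}\in\mathbb{R}^{l\times n_2\times n_3}$ in the HTD/TD format with core tensors $\mathscr{G}\in\mathbb{R}^{r_1\times r_2\times r_3}$ and $\mathscr{H}\in\mathbb{R}^{s_1\times s_2\times s_3}$ and factor matrices $\mathbf{U}_t$ and $\mathbf{V}_t$, $t=1,2,3$, respectively, their T-product $\mathscr{T}\star\mathscr{S}\in\mathbb{R}^{n_1\times n_2\times n_3}$ admits an HTD/TD representation with core tensor $\mathscr{P}=\widetilde{\mathscr{P}}\times_3\mathbf{F}_{n_3}^{-1}\in\mathbb{R}^{r_1\times s_2\times n_3}$ where $$\widetilde{\mathscr{P}}(\alpha_1,\beta_2,\gamma_3)=\sum_{\alpha_2=1}^{r_2}\sum_{\beta_1=1}^{s_1}\sum_{\alpha_3=1}^{r_3}\sum_{\beta_3=1}^{s_3}\mathscr{G}(\alpha_1,\alpha_2,\alpha_3)\,\mathbf{M}(\alpha_2,\beta_1)\,\mathscr{H}(\beta_1,\beta_2,\beta_3)\,\widetilde{\mathbf{U}}_3(\gamma_3,\alpha_3)\,\widetilde{\mathbf{V}}_3(\gamma_3,\beta_3),$$ with $\mathbf{M}=\mathbf{U}_2^\top\mathbf{V}_1\in\mathbb{R}^{r_2\times s_1}$, $\widetilde{\mathbf{U}}_3=\mathbf{F}_{n_3}\mathbf{U}_3\in\mathbb{C}^{n_3\times r_3}$, and $\widetilde{\mathbf{V}}_3=\mathbf{F}_{n_3}\mathbf{V}_3\in\mathbb{C}^{n_3\times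 s_3}$, and with factor matrices $\mathbf{U}_1$, $\mathbf{V}_2$, and $\mathbf{I}_{n_3}$.
   Context: For third-order tensors, the hierarchical Tucker (HTD) format is taken to be the standard Tucker (TD) format: a tensor with core tensor $\mathscr{C}$ and factor matrices $\mathbf{A}_1,\mathbf{A}_2,\mathbf{A}_3$ is $\mathscr{C}\times_1\mathbf{A}_1\times_2\mathbf{A}_2\times_3\mathbf{A}_3$. Here $\mathscr{T}=\mathscr{G}\times_1\mathbf{U}_1\times_2\mathbf{U}_2\times_3\mathbf{U}_3$ with $\mathbf{U}_1\in\mathbb{R}^{n_1\times r_1}$, $\mathbf{U}_2\in\mathbb{R}^{l\times r_2}$, $\mathbf{U}_3\in\mathbb{R}^{n_3\times r_3}$, and $\mathscr{S}=\mathscr{H}\times_1\mathbf{V}_1\times_2\mathbf{V}_2\times_3\mathbf{V}_3$ with $\mathbf{V}_1\in\mathbb{R}^{l\times s_1}$, $\mathbf{V}_2\in\mathbb{R}^{n_2\times s_2}$, $\mathbf{V}_3\in\mathbb{R}^{n_3\times s_3}$. Mode-$p$ multiplication $\mathscr{X}\times_p\mathbf{A}$ has entry with $p$-th index $i$ equal to $\sum_{j_p}\mathbf{A}(i,j_p)\mathscr{X}(\dots,j_p,\dots)$. $\mathbf{F}_{n}\in\mathbb{C}^{n\times n}$ is the discrete Fourier transform matrix $\mathbf{F}_n(p,q)=\frac{1}{\sqrt{n}}\,\omega^{(p-1)(q-1)}$, $\omega=\exp(-2\pi i/n)$; $\mathbf{I}_{n}$ is the $n\times n$ identity matrix. T-product: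 $\mathscr{T}\star\mathscr{S}=\texttt{fold}(\texttt{bcirc}(\mathscr{T})\,\texttt{unfold}(\mathscr{S}))$, where $\texttt{bcirc}(\mathscr{T})$ is the $n_3\times n_3$ block matrix with $(p,q)$ block $\mathscr{T}(:,:,((p-q)\bmod n_3)+1)$, $\texttt{unfold}(\mathscr{S})$ stacks the frontal slices $\mathscr{S}(:,:,1),\dots,\mathscr{S}(:,:,n_3)$ vertically, and $\texttt{fold}$ is the inverse of $\texttt{unfold}$.
   Formalization: With the unitary normalisation of F_{n_3} the printed core tensor is off by a scalar; the formal statement uses the core √(n_3)·(P̃ ×_3 F_{n_3}^{-1}) in place of P̃ ×_3 F_{n_3}^{-1}. *)

theory Defs
  imports Complex_Main "Jordan_Normal_Form.Gauss_Jordan_Elimination"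
begin

(* Third-order tensors carry their three dimensions, like the matrices of
   Jordan_Normal_Form. Indices start at 0. The entries outside the index box are fixed, so that
   equality of tensors means equal dimensions and equal entries. *)

typedef 'a tensor3 =
  "{(n1, n2, n3, f) | n1 n2 n3 (f :: nat \<times> nat \<times> nat \<Rightarrow> 'a).
      \<forall>i j k. \<not> (i < n1 \<and> j < n2 \<and> k < n3) \<longrightarrow> f (i, j, k) = undefined}"
  by (rule exI[of _ "(0, 0, 0, \<lambda>_. undefined)"]) auto

setup_lifting type_definition_tensor3

lift_definition dim1 :: "'a tensor3 \<Rightarrow> nat" is fst .
lift_definition dim2 :: "'a tensor3 \<Rightarrow> nat" is "fst \<circ> snd" .
lift_definition dim3 :: "'a tensor3 \<Rightarrow> nat" is "fst \<circ> snd \<circ> snd" .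

lift_definition index_tensor3 :: "'a tensor3 \<Rightarrow> nat \<times> nat \<times> nat \<Rightarrow> 'a" (infixl \<open>$$$\<close> 100)
  is "snd \<circ> snd \<circ> snd" .

lift_definition tensor3 :: "nat \<Rightarrow> nat \<Rightarrow> nat \<Rightarrow> (nat \<times> nat \<times> nat \<Rightarrow> 'a) \<Rightarrow> 'a tensor3"
  is "\<lambda>n1 n2 n3 f. (n1, n2, n3,
        \<lambda>(i, j, k). if i < n1 \<and> j < n2 \<and> k < n3 then f (i, j, k) else undefined)"
  by auto

definition carrier_tensor3 :: "nat \<Rightarrow> nat \<Rightarrow> nat \<Rightarrow> 'a tensor3 set" where
  "carrier_tensor3 n1 n2 n3 = {X. dim1 X = n1 \<and> dim2 X = n2 \<and> dim3 X = n3}"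

lemma dim_tensor3 [simp]:
  "dim1 (tensor3 n1 n2 n3 f) = n1"
  "dim2 (tensor3 n1 n2 n3 f) = n2"
  "dim3 (tensor3 n1 n2 n3 f) = n3"
  by (transfer, simp)+

lemma index_tensor3 [simp]:
  "i < n1 \<Longrightarrow> j < n2 \<Longrightarrow> k < n3 \<Longrightarrow> tensor3 n1 n2 n3 f $$$ (i, j, k) = f (i, j, k)"
  by transfer simp

lemma tensor3_eqI:
  assumes "dim1 X = dim1 Y" "dim2 X = dim2 Y" "dim3 X = dim3 Y"
    and "\<And>i j k. i < dim1 Y \<Longrightarrow> j < dim2 Y \<Longrightarrow> k < dim3 Y \<Longrightarrow> X $$$ (i, j, k) = Y $$$ (i, j, k)"
  shows "X = Y"
  using assms by transfer (clarsimp simp: fun_eq_iff, metis)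

definition map_tensor3 :: "('a \<Rightarrow> 'b) \<Rightarrow> 'a tensor3 \<Rightarrow> 'b tensor3" where
  "map_tensor3 h X = tensor3 (dim1 X) (dim2 X) (dim3 X) (\<lambda>ix. h (X $$$ ix))"

definition smult_tensor3 :: "'a :: times \<Rightarrow> 'a tensor3 \<Rightarrow> 'a tensor3" (infixl \<open>\<cdot>\<^sub>t\<close> 70) where
  "c \<cdot>\<^sub>t X = map_tensor3 ((*) c) X"

definition mode1_mult :: "'a :: semiring_0 tensor3 \<Rightarrow> 'a mat \<Rightarrow> 'a tensor3" (infixl \<open>\<times>\<^sub>1\<close> 70) where
  "X \<times>\<^sub>1 A = tensor3 (dim_row A) (dim2 X) (dim3 X)
     (\<lambda>(i, j, k). \<Sum>p<dim1 X. A $$ (i, p) * X $$$ (p, j, k))"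

definition mode2_mult :: "'a :: semiring_0 tensor3 \<Rightarrow> 'a mat \<Rightarrow> 'a tensor3" (infixl \<open>\<times>\<^sub>2\<close> 70) where
  "X \<times>\<^sub>2 A = tensor3 (dim1 X) (dim_row A) (dim3 X)
     (\<lambda>(i, j, k). \<Sum>p<dim2 X. A $$ (j, p) * X $$$ (i, p, k))"

definition mode3_mult :: "'a :: semiring_0 tensor3 \<Rightarrow> 'a mat \<Rightarrow> 'a tensor3" (infixl \<open>\<times>\<^sub>3\<close> 70) where
  "X \<times>\<^sub>3 A = tensor3 (dim1 X) (dim2 X) (dim_row A)
     (\<lambda>(i, j, k). \<Sum>p<dim3 X. A $$ (k, p) * X $$$ (i, j, p))"

definition tucker ::
    "'a :: semiring_0 tensor3 \<Rightarrow> 'a mat \<Rightarrow> 'a mat \<Rightarrow> 'a mat \<Rightarrow> 'a tensor3" where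
  "tucker C A1 A2 A3 = C \<times>\<^sub>1 A1 \<times>\<^sub>2 A2 \<times>\<^sub>3 A3"

definition frontal_slice :: "'a tensor3 \<Rightarrow> nat \<Rightarrow> 'a mat" where
  "frontal_slice X k = mat (dim1 X) (dim2 X) (\<lambda>(i, j). X $$$ (i, j, k))"

(* Row r of the block matrix is row r mod dim1 X of block row r div dim1 X, and likewise for
   columns. The block index p - q is taken in int, since nat subtraction truncates. *)
definition bcirc :: "'a tensor3 \<Rightarrow> 'a mat" where
  "bcirc X = mat (dim1 X * dim3 X) (dim2 X * dim3 X)
     (\<lambda>(r, c). let p = r div dim1 X; q = c div dim2 X in
        frontal_slice X (nat ((int p - int q) mod int (dim3 X))) $$ (r mod dim1 X, c mod dim2 X))"

definition unfold :: "'a tensor3 \<Rightarrow> 'a mat" where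
  "unfold X = mat (dim1 X * dim3 X) (dim2 X)
     (\<lambda>(r, c). frontal_slice X (r div dim1 X) $$ (r mod dim1 X, c))"

(* A stacked matrix does not determine the number and the height of its blocks, so fold_tensor3
   takes them as arguments: n blocks of height m. *)
definition fold_tensor3 :: "nat \<Rightarrow> nat \<Rightarrow> 'a mat \<Rightarrow> 'a tensor3" where
  "fold_tensor3 m n A = tensor3 m (dim_col A) n (\<lambda>(i, j, k). A $$ (k * m + i, j))"

lemma block_index_less:
  fixes i k m n :: nat
  assumes "i < m" "k < n"
  shows "k * m + i < m * n"
proof -
  have "k * m + i < Suc k * m" using assms(1) by simp
  also have "\<dots> \<le> n * m" using assms(2) by (intro mult_le_mono1) simp
  finally show ?thesis by (simp add: mult.commute)
qed

lemma fold_unfold: "fold_tensor3 (dim1 X) (dim3 X) (unfold X) = X"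
  by (rule tensor3_eqI)
     (auto simp: fold_tensor3_def unfold_def frontal_slice_def block_index_less)

lemma unfold_fold:
  assumes "A \<in> carrier_mat (m * n) c"
  shows "unfold (fold_tensor3 m n A) = A"
proof (rule eq_matI)
  fix i j assume "i < dim_row A" "j < dim_col A"
  then have i: "i < m * n" and j: "j < dim_col A" using assms by auto
  have "m > 0" using i by (cases m) auto
  moreover have "i div m < n" using i by (simp add: less_mult_imp_div_less mult.commute)
  ultimately show "unfold (fold_tensor3 m n A) $$ (i, j) = A $$ (i, j)"
    using i j by (simp add: fold_tensor3_def unfold_def frontal_slice_def)
qed (use assms in \<open>auto simp: fold_tensor3_def unfold_def\<close>)

definition t_product :: "'a :: semiring_0 tensor3 \<Rightarrow> 'a tensor3 \<Rightarrow> 'a tensor3" (infixl \<open>\<star>\<close> 70) where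
  "X \<star> Y = fold_tensor3 (dim1 X) (dim3 X) (bcirc X * unfold Y)"

(* This is the unitary normalisation of the discrete Fourier transform. With it the transform of
   a circular convolution is sqrt n times the entrywise product of the transforms. *)
definition dft :: "nat \<Rightarrow> complex mat" where
  "dft n = mat n n (\<lambda>(p, q).
     1 / complex_of_real (sqrt (real n)) * exp (- 2 * complex_of_real pi * \<i> / of_nat n) ^ (p * q))"

end

theory Submission
  imports Defs "Jordan_Normal_Form.Determinant"
begin

text \<open>
  Everything follows from three facts about the T-product, which is a product of matrices whose
  entries are tubes, multiplied by circular convolution.

  First, the T-product acts on the first index of the left factor and on the second index of the
  right factor as a matrix product does, so it commutes with a mode-1 product on the left factor
  and with a mode-2 product on the right factor (\<open>mode1_t_product\<close>, \<open>t_product_mode2\<close>).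
  Mode products along different modes commute, so \<open>U\<^sub>1\<close> and \<open>V\<^sub>2\<close> can be pulled out of the product,
  and what remains, the T-product of \<open>\<G> \<times>\<^sub>2 U\<^sub>2 \<times>\<^sub>3 U\<^sub>3\<close> and \<open>\<H> \<times>\<^sub>1 V\<^sub>1 \<times>\<^sub>3 V\<^sub>3\<close>, is a real tensor
  of the size of the required core. It is the witness for the core \<open>P\<close>. Choosing it
  in this way shows that the core is real although its formula goes through complex numbers.

  Second, the Fourier transform along the third mode turns the convolution of tubes into an
  entrywise product, up to the factor \<open>sqrt n\<^sub>3\<close> caused by the unitary normalisation
  (\<open>dft_t_product\<close>). Since consecutive mode-3 products compose, the transform replaces \<open>U\<^sub>3\<close> and
  \<open>V\<^sub>3\<close> by their transforms, and the sum over the contracted index of size \<open>l\<close> only involves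
  \<open>U\<^sub>2\<close> and \<open>V\<^sub>1\<close>, where it produces \<open>M\<close> (\<open>sum_contracted_index\<close>). Hence the transform of \<open>P\<close> is
  \<open>sqrt n\<^sub>3\<close> times the tensor \<open>Pt\<close>.

  Third, the Fourier matrix is invertible because distinct powers of the root of unity
  are orthogonal (\<open>dft_mult_cnj\<close>), so the last identity can be solved for \<open>P\<close>.
\<close>

section \<open>Mode products\<close>

lemma dim_mode_mult [simp]:
  "dim1 (X \<times>\<^sub>1 A) = dim_row A" "dim2 (X \<times>\<^sub>1 A) = dim2 X" "dim3 (X \<times>\<^sub>1 A) = dim3 X"
  "dim1 (X \<times>\<^sub>2 A) = dim1 X" "dim2 (X \<times>\<^sub>2 A) = dim_row A" "dim3 (X \<times>\<^sub>2 A) = dim3 X"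
  "dim1 (X \<times>\<^sub>3 A) = dim1 X" "dim2 (X \<times>\<^sub>3 A) = dim2 X" "dim3 (X \<times>\<^sub>3 A) = dim_row A"
  by (simp_all add: mode1_mult_def mode2_mult_def mode3_mult_def)

lemma index_mode1_mult [simp]:
  "i < dim_row A \<Longrightarrow> j < dim2 X \<Longrightarrow> k < dim3 X \<Longrightarrow>
    (X \<times>\<^sub>1 A) $$$ (i, j, k) = (\<Sum>p<dim1 X. A $$ (i, p) * X $$$ (p, j, k))"
  by (simp add: mode1_mult_def)

lemma index_mode2_mult [simp]:
  "i < dim1 X \<Longrightarrow> j < dim_row A \<Longrightarrow> k < dim3 X \<Longrightarrow>
    (X \<times>\<^sub>2 A) $$$ (i, j, k) = (\<Sum>p<dim2 X. A $$ (j, p) * X $$$ (i, p, k))"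
  by (simp add: mode2_mult_def)

lemma index_mode3_mult [simp]:
  "i < dim1 X \<Longrightarrow> j < dim2 X \<Longrightarrow> k < dim_row A \<Longrightarrow>
    (X \<times>\<^sub>3 A) $$$ (i, j, k) = (\<Sum>p<dim3 X. A $$ (k, p) * X $$$ (i, j, p))"
  by (simp add: mode3_mult_def)

lemma mode1_mode2_commute:
  fixes X :: "'a :: comm_semiring_0 tensor3"
  shows "X \<times>\<^sub>1 A \<times>\<^sub>2 B = X \<times>\<^sub>2 B \<times>\<^sub>1 A"
proof (rule tensor3_eqI)
  fix i j k
  assume "i < dim1 (X \<times>\<^sub>2 B \<times>\<^sub>1 A)" "j < dim2 (X \<times>\<^sub>2 B \<times>\<^sub>1 A)" "k < dim3 (X \<times>\<^sub>2 B \<times>\<^sub>1 A)"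
  then show "(X \<times>\<^sub>1 A \<times>\<^sub>2 B) $$$ (i, j, k) = (X \<times>\<^sub>2 B \<times>\<^sub>1 A) $$$ (i, j, k)"
    by (simp add: sum_distrib_left mult.left_commute)
      (rule sum.swap)
qed simp_all

lemma mode1_mode3_commute:
  fixes X :: "'a :: comm_semiring_0 tensor3"
  shows "X \<times>\<^sub>1 A \<times>\<^sub>3 B = X \<times>\<^sub>3 B \<times>\<^sub>1 A"
proof (rule tensor3_eqI)
  fix i j k
  assume "i < dim1 (X \<times>\<^sub>3 B \<times>\<^sub>1 A)" "j < dim2 (X \<times>\<^sub>3 B \<times>\<^sub>1 A)" "k < dim3 (X \<times>\<^sub>3 B \<times>\<^sub>1 A)"
  then show "(X \<times>\<^sub>1 A \<times>\<^sub>3 B) $$$ (i, j, k) = (X \<times>\<^sub>3 B \<times>\<^sub>1 A) $$$ (i, j, k)"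
    by (simp add: sum_distrib_left mult.left_commute)
      (rule sum.swap)
qed simp_all

lemma mode2_mode3_commute:
  fixes X :: "'a :: comm_semiring_0 tensor3"
  shows "X \<times>\<^sub>2 A \<times>\<^sub>3 B = X \<times>\<^sub>3 B \<times>\<^sub>2 A"
proof (rule tensor3_eqI)
  fix i j k
  assume "i < dim1 (X \<times>\<^sub>3 B \<times>\<^sub>2 A)" "j < dim2 (X \<times>\<^sub>3 B \<times>\<^sub>2 A)" "k < dim3 (X \<times>\<^sub>3 B \<times>\<^sub>2 A)"
  then show "(X \<times>\<^sub>2 A \<times>\<^sub>3 B) $$$ (i, j, k) = (X \<times>\<^sub>3 B \<times>\<^sub>2 A) $$$ (i, j, k)"
    by (simp add: sum_distrib_left mult.left_commute)
      (rule sum.swap)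
qed simp_all

lemma index_mult_mat_sum:
  assumes "i < dim_row A" "j < dim_col B" "dim_row B = dim_col A"
  shows "(A * B) $$ (i, j) = (\<Sum>p<dim_col A. A $$ (i, p) * B $$ (p, j))"
  using assms by (simp add: scalar_prod_def atLeast0LessThan)

lemma mode3_mult_mult:
  assumes "dim_col A = dim3 X" "dim_col B = dim_row A"
  shows "X \<times>\<^sub>3 A \<times>\<^sub>3 B = X \<times>\<^sub>3 (B * A)"
proof (rule tensor3_eqI)
  fix i j k
  assume "i < dim1 (X \<times>\<^sub>3 (B * A))" "j < dim2 (X \<times>\<^sub>3 (B * A))" "k < dim3 (X \<times>\<^sub>3 (B * A))"
  with assms show "(X \<times>\<^sub>3 A \<times>\<^sub>3 B) $$$ (i, j, k) = (X \<times>\<^sub>3 (B * A)) $$$ (i, j, k)"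
    by (simp add: index_mult_mat_sum sum_distrib_left sum_distrib_right mult.assoc
          del: index_mult_mat(1))
      (rule sum.swap)
qed simp_all

lemma mode3_mult_one:
  fixes X :: "'a :: semiring_1 tensor3"
  shows "X \<times>\<^sub>3 1\<^sub>m (dim3 X) = X"
proof (rule tensor3_eqI)
  fix i j k
  assume "i < dim1 X" "j < dim2 X" "k < dim3 X"
  then show "(X \<times>\<^sub>3 1\<^sub>m (dim3 X)) $$$ (i, j, k) = X $$$ (i, j, k)"
    by (simp add: if_distrib[where f = "\<lambda>x. x * _"] cong: if_cong)
qed simp_all

lemma dim_smult_tensor3 [simp]:
  "dim1 (c \<cdot>\<^sub>t X) = dim1 X" "dim2 (c \<cdot>\<^sub>t X) = dim2 X" "dim3 (c \<cdot>\<^sub>t X) = dim3 X"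
  by (simp_all add: smult_tensor3_def map_tensor3_def)

lemma index_smult_tensor3 [simp]:
  "i < dim1 X \<Longrightarrow> j < dim2 X \<Longrightarrow> k < dim3 X \<Longrightarrow> (c \<cdot>\<^sub>t X) $$$ (i, j, k) = c * X $$$ (i, j, k)"
  by (simp add: smult_tensor3_def map_tensor3_def)

lemma smult_mode3_mult:
  fixes X :: "'a :: comm_semiring_0 tensor3"
  shows "c \<cdot>\<^sub>t (X \<times>\<^sub>3 A) = (c \<cdot>\<^sub>t X) \<times>\<^sub>3 A"
  by (rule tensor3_eqI) (simp_all add: sum_distrib_left mult.left_commute)

section \<open>The T-product as convolution of tubes\<close>

lemma sum_blocks:
  fixes g :: "nat \<Rightarrow> 'a :: comm_monoid_add"
  shows "(\<Sum>c<m * n. g c) = (\<Sum>q<n. \<Sum>s<m. g (q * m + s))"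
proof -
  have "(\<Sum>c<m * n. g c) = (\<Sum>q<n. sum g {q * m..<q * m + m})"
    by (simp add: sum.nat_group mult.commute)
  also have "\<dots> = (\<Sum>q<n. \<Sum>s<m. g (q * m + s))"
    using sum.shift_bounds_nat_ivl[of g 0 "_ * m" m]
    by (simp add: atLeast0LessThan add.commute)
  finally show ?thesis .
qed

lemma dim_t_product [simp]:
  "dim1 (X \<star> Y) = dim1 X" "dim2 (X \<star> Y) = dim2 Y" "dim3 (X \<star> Y) = dim3 X"
  by (simp_all add: t_product_def fold_tensor3_def unfold_def)

text \<open>The offset that the circulant matrix puts at block row \<open>k\<close> and block column \<open>q\<close>.\<close>

abbreviation cdiff :: "nat \<Rightarrow> nat \<Rightarrow> nat \<Rightarrow> nat" where
  "cdiff n k q \<equiv> nat ((int k - int q) mod int n)"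

lemma cdiff_less: "q < n \<Longrightarrow> cdiff n k q < n"
  by (simp add: nat_less_iff)

text \<open>
  Block rows have height \<open>dim1 X\<close> and block columns width \<open>dim2 X\<close>, so the column index of the
  block circulant matrix is a pair of a block \<open>q\<close> and an index \<open>s\<close> inside it.
\<close>

lemma index_t_product:
  assumes "dim2 X = dim1 Y" "dim3 X = dim3 Y"
    and "i < dim1 X" "j < dim2 Y" "k < dim3 X"
  shows "(X \<star> Y) $$$ (i, j, k) =
    (\<Sum>q<dim3 X. \<Sum>s<dim2 X. X $$$ (i, s, cdiff (dim3 X) k q) * Y $$$ (s, j, q))"
proof -
  have row: "k * dim1 X + i < dim1 X * dim3 X"
    using assms by (simp add: block_index_less)
  have "(X \<star> Y) $$$ (i, j, k) = (bcirc X * unfold Y) $$ (k * dim1 X + i, j)"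
    using assms by (simp add: t_product_def fold_tensor3_def unfold_def)
  also have "\<dots> = (\<Sum>c<dim2 X * dim3 X.
      bcirc X $$ (k * dim1 X + i, c) * unfold Y $$ (c, j))"
    using assms row by (subst index_mult_mat_sum) (simp_all add: bcirc_def unfold_def)
  also have "\<dots> = (\<Sum>q<dim3 X. \<Sum>s<dim2 X.
      bcirc X $$ (k * dim1 X + i, q * dim2 X + s) * unfold Y $$ (q * dim2 X + s, j))"
    by (rule sum_blocks)
  also have "\<dots> = (\<Sum>q<dim3 X. \<Sum>s<dim2 X. X $$$ (i, s, cdiff (dim3 X) k q) * Y $$$ (s, j, q))"
  proof (intro sum.cong refl)
    fix q s assume "q \<in> {..<dim3 X}" "s \<in> {..<dim2 X}"
    moreover from this have "q * dim2 X + s < dim2 X * dim3 X"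
      by (simp add: block_index_less)
    ultimately show "bcirc X $$ (k * dim1 X + i, q * dim2 X + s) * unfold Y $$ (q * dim2 X + s, j)
        = X $$$ (i, s, cdiff (dim3 X) k q) * Y $$$ (s, j, q)"
      using assms row by (simp add: bcirc_def unfold_def frontal_slice_def Let_def)
  qed
  finally show ?thesis .
qed

lemma mode1_t_product:
  fixes X Y :: "'a :: comm_semiring_0 tensor3"
  assumes "dim2 X = dim1 Y" "dim3 X = dim3 Y"
  shows "(X \<times>\<^sub>1 A) \<star> Y = (X \<star> Y) \<times>\<^sub>1 A"
proof (rule tensor3_eqI)
  fix i j k
  assume ijk: "i < dim1 ((X \<star> Y) \<times>\<^sub>1 A)" "j < dim2 ((X \<star> Y) \<times>\<^sub>1 A)" "k < dim3 ((X \<star> Y) \<times>\<^sub>1 A)"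
  let ?f = "\<lambda>p q s. A $$ (i, p) * (X $$$ (p, s, cdiff (dim3 X) k q) * Y $$$ (s, j, q))"
  have "((X \<times>\<^sub>1 A) \<star> Y) $$$ (i, j, k) = (\<Sum>q<dim3 X. \<Sum>s<dim2 X. \<Sum>p<dim1 X. ?f p q s)"
    using assms ijk
    by (simp add: index_t_product cdiff_less sum_distrib_right mult.assoc)
  also have "\<dots> = (\<Sum>q<dim3 X. \<Sum>p<dim1 X. \<Sum>s<dim2 X. ?f p q s)"
    by (intro sum.cong refl sum.swap)
  also have "\<dots> = (\<Sum>p<dim1 X. \<Sum>q<dim3 X. \<Sum>s<dim2 X. ?f p q s)"
    by (rule sum.swap)
  also have "\<dots> = ((X \<star> Y) \<times>\<^sub>1 A) $$$ (i, j, k)"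
    using assms ijk by (simp add: index_t_product sum_distrib_left)
  finally show "((X \<times>\<^sub>1 A) \<star> Y) $$$ (i, j, k) = ((X \<star> Y) \<times>\<^sub>1 A) $$$ (i, j, k)" .
qed simp_all

lemma t_product_mode2:
  fixes X Y :: "'a :: comm_semiring_0 tensor3"
  assumes "dim2 X = dim1 Y" "dim3 X = dim3 Y"
  shows "X \<star> (Y \<times>\<^sub>2 B) = (X \<star> Y) \<times>\<^sub>2 B"
proof (rule tensor3_eqI)
  fix i j k
  assume ijk: "i < dim1 ((X \<star> Y) \<times>\<^sub>2 B)" "j < dim2 ((X \<star> Y) \<times>\<^sub>2 B)" "k < dim3 ((X \<star> Y) \<times>\<^sub>2 B)"
  let ?f = "\<lambda>p q s. B $$ (j, p) * (X $$$ (i, s, cdiff (dim3 X) k q) * Y $$$ (s, p, q))"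
  have "(X \<star> (Y \<times>\<^sub>2 B)) $$$ (i, j, k) = (\<Sum>q<dim3 X. \<Sum>s<dim2 X. \<Sum>p<dim2 Y. ?f p q s)"
    using assms ijk
    by (simp add: index_t_product sum_distrib_left mult.left_commute)
  also have "\<dots> = (\<Sum>q<dim3 X. \<Sum>p<dim2 Y. \<Sum>s<dim2 X. ?f p q s)"
    by (intro sum.cong refl sum.swap)
  also have "\<dots> = (\<Sum>p<dim2 Y. \<Sum>q<dim3 X. \<Sum>s<dim2 X. ?f p q s)"
    by (rule sum.swap)
  also have "\<dots> = ((X \<star> Y) \<times>\<^sub>2 B) $$$ (i, j, k)"
    using assms ijk by (simp add: index_t_product sum_distrib_left)
  finally show "(X \<star> (Y \<times>\<^sub>2 B)) $$$ (i, j, k) = ((X \<star> Y) \<times>\<^sub>2 B) $$$ (i, j, k)" .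
qed simp_all

section \<open>From real to complex tensors\<close>

lemma dim_map_tensor3 [simp]:
  "dim1 (map_tensor3 h X) = dim1 X"
  "dim2 (map_tensor3 h X) = dim2 X"
  "dim3 (map_tensor3 h X) = dim3 X"
  by (simp_all add: map_tensor3_def)

lemma index_map_tensor3 [simp]:
  "i < dim1 X \<Longrightarrow> j < dim2 X \<Longrightarrow> k < dim3 X \<Longrightarrow>
    map_tensor3 h X $$$ (i, j, k) = h (X $$$ (i, j, k))"
  by (simp add: map_tensor3_def)

lemma map_tensor3_of_real_mode1:
  assumes "dim_col A = dim1 X"
  shows "map_tensor3 complex_of_real (X \<times>\<^sub>1 A) =
    map_tensor3 complex_of_real X \<times>\<^sub>1 map_mat complex_of_real A"
  using assms by (intro tensor3_eqI) simp_all

lemma map_tensor3_of_real_mode2: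
  assumes "dim_col A = dim2 X"
  shows "map_tensor3 complex_of_real (X \<times>\<^sub>2 A) =
    map_tensor3 complex_of_real X \<times>\<^sub>2 map_mat complex_of_real A"
  using assms by (intro tensor3_eqI) simp_all

lemma map_tensor3_of_real_mode3:
  assumes "dim_col A = dim3 X"
  shows "map_tensor3 complex_of_real (X \<times>\<^sub>3 A) =
    map_tensor3 complex_of_real X \<times>\<^sub>3 map_mat complex_of_real A"
  using assms by (intro tensor3_eqI) simp_all

lemma map_tensor3_of_real_t_product:
  assumes "dim2 X = dim1 Y" "dim3 X = dim3 Y"
  shows "map_tensor3 complex_of_real (X \<star> Y) =
    map_tensor3 complex_of_real X \<star> map_tensor3 complex_of_real Y"
  using assms by (intro tensor3_eqI) (simp_all add: index_t_product cdiff_less)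

section \<open>The discrete Fourier transform\<close>

definition dft_root :: "nat \<Rightarrow> complex" where
  "dft_root n = exp (- 2 * complex_of_real pi * \<i> / of_nat n)"

lemma dim_dft [simp]: "dim_row (dft n) = n" "dim_col (dft n) = n"
  by (simp_all add: dft_def)

lemma index_dft:
  "p < n \<Longrightarrow> q < n \<Longrightarrow>
    dft n $$ (p, q) = 1 / complex_of_real (sqrt (real n)) * dft_root n ^ (p * q)"
  by (simp add: dft_def dft_root_def)

lemma dft_root_power_cis: "dft_root n ^ k = cnj (cis (2 * pi * real k / real n))"
proof -
  have "dft_root n = cis (- (2 * pi / real n))"
    by (simp add: dft_root_def cis_conv_exp mult.commute)
  then show ?thesis
    by (simp add: DeMoivre cis_cnj mult.commute)
qed

lemma dft_root_power_self: "dft_root n ^ n = 1"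
  by (cases "n = 0") (simp_all add: dft_root_power_cis)

lemma dft_root_power_inj:
  assumes "p < n" "q < n" "dft_root n ^ p = dft_root n ^ q"
  shows "p = q"
proof -
  have "bij_betw (\<lambda>k. cis (2 * pi * real k / real n)) {..<n} {z. z ^ n = 1}"
    using assms by (intro bij_betw_roots_unity) simp
  then have "inj_on (\<lambda>k. cis (2 * pi * real k / real n)) {..<n}"
    by (rule bij_betw_imp_inj_on)
  with assms show ?thesis
    by (auto simp: dft_root_power_cis inj_on_def)
qed

text \<open>
  The entry of the product at \<open>(p, r)\<close> is a geometric sum whose ratio \<open>z\<close> is the quotient of the
  powers \<open>p\<close> and \<open>r\<close> of the root. It is an \<open>n\<close>-th root of unity, so the sum vanishes unless the
  ratio is 1, which by injectivity of the powers happens only on the diagonal.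
\<close>

lemma dft_mult_cnj: "dft n * map_mat cnj (dft n) = 1\<^sub>m n"
proof (rule eq_matI)
  fix p r assume "p < dim_row (1\<^sub>m n :: complex mat)" "r < dim_col (1\<^sub>m n :: complex mat)"
  then have pr: "p < n" "r < n" by simp_all
  let ?w = "dft_root n"
  define z where "z = ?w ^ p * cnj (?w ^ r)"
  have unit: "?w ^ k * cnj (?w ^ k) = 1" for k
    by (simp add: dft_root_power_cis cis_cnj cis_mult)
  have sqrt: "complex_of_real (sqrt (real n)) * complex_of_real (sqrt (real n)) = of_nat n"
    by (simp flip: of_real_mult)
  have "(dft n * map_mat cnj (dft n)) $$ (p, r) =
      (\<Sum>q<n. dft n $$ (p, q) * cnj (dft n $$ (q, r)))"
    using pr by (subst index_mult_mat_sum) simp_all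
  also have "\<dots> = (\<Sum>q<n. 1 / of_nat n * z ^ q)"
  proof (intro sum.cong refl)
    fix q assume "q \<in> {..<n}"
    then have "dft n $$ (p, q) * cnj (dft n $$ (q, r)) =
        1 / (complex_of_real (sqrt (real n)) * complex_of_real (sqrt (real n)))
          * (?w ^ (p * q) * cnj (?w ^ (r * q)))"
      using pr by (simp add: index_dft mult.commute)
    also have "?w ^ (p * q) * cnj (?w ^ (r * q)) = z ^ q"
      by (simp add: z_def power_mult power_mult_distrib)
    finally show "dft n $$ (p, q) * cnj (dft n $$ (q, r)) = 1 / of_nat n * z ^ q"
      by (simp only: sqrt)
  qed
  also have "\<dots> = 1 / of_nat n * (\<Sum>q<n. z ^ q)"
    by (simp add: sum_distrib_left)
  also have "\<dots> = 1\<^sub>m n $$ (p, r)"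
  proof (cases "p = r")
    case True
    then have "z = 1" using unit by (simp add: z_def)
    with pr True show ?thesis by simp
  next
    case False
    have "z ^ n = (?w ^ n) ^ p * cnj ((?w ^ n) ^ r)"
      by (simp add: z_def power_mult_distrib flip: power_mult) (simp add: mult.commute)
    then have "z ^ n = 1" by (simp add: dft_root_power_self)
    moreover have "z \<noteq> 1"
    proof
      assume "z = 1"
      then have "?w ^ r = ?w ^ p * (?w ^ r * cnj (?w ^ r))"
        by (simp add: z_def mult.left_commute)
      then have "?w ^ r = ?w ^ p" by (simp only: unit mult_1_right)
      with dft_root_power_inj pr False show False by blast
    qed
    ultimately show ?thesis
      using pr False by (simp add: geometric_sum)
  qed
  finally show "(dft n * map_mat cnj (dft n)) $$ (p, r) = 1\<^sub>m n $$ (p, r)" .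
qed simp_all

lemma mat_inverse_dft:
  "the (mat_inverse (dft n)) \<in> carrier_mat n n \<and> the (mat_inverse (dft n)) * dft n = 1\<^sub>m n"
proof -
  have carr: "dft n \<in> carrier_mat n n" "map_mat cnj (dft n) \<in> carrier_mat n n"
    by (auto intro!: carrier_matI)
  have "map_mat cnj (dft n) * dft n = 1\<^sub>m n"
    by (rule mat_mult_left_right_inverse[OF carr dft_mult_cnj])
  with carr dft_mult_cnj[of n] have "dft n \<in> Units (ring_mat TYPE(complex) n ())"
    unfolding Units_def ring_mat_simps by blast
  \<comment> \<open>A unit of the matrix ring rules out the failure value of the elimination algorithm.\<close>
  with mat_inverse(1)[OF carr(1), where b = "()"] obtain B where "mat_inverse (dft n) = Some B"
    by (cases "mat_inverse (dft n)") auto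
  with mat_inverse(2)[OF carr(1)] show ?thesis by simp
qed

text \<open>
  The substitution \<open>p = k - q\<close> modulo \<open>n\<close> separates the two sums; powers of \<open>w\<close> only depend on
  the exponent modulo \<open>n\<close>.
\<close>

lemma circular_convolution_power_sum:
  fixes w :: "'a :: comm_semiring_1"
  assumes "w ^ n = 1"
  shows "(\<Sum>k<n. w ^ k * (\<Sum>q<n. u (cdiff n k q) * v q)) =
    (\<Sum>p<n. w ^ p * u p) * (\<Sum>q<n. w ^ q * v q)"
proof -
  have power_mod: "w ^ (m mod n) = w ^ m" for m
  proof -
    have "w ^ (n * (m div n) + m mod n) = w ^ (m mod n)"
      by (simp only: power_add power_mult assms power_one mult_1_left)
    then show ?thesis by simp
  qed
  have shift: "(\<Sum>k<n. w ^ k * u (cdiff n k q)) = (\<Sum>p<n. w ^ (p + q) * u p)" if "q < n" for q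
  proof (rule sum.reindex_bij_witness[where j = "\<lambda>k. cdiff n k q" and i = "\<lambda>p. (p + q) mod n"])
    fix k assume "k \<in> {..<n}"
    then have k: "k < n" by simp
    have "int ((cdiff n k q + q) mod n) = int k"
      using k that by (simp add: zmod_int mod_add_left_eq)
    then show inverse: "(cdiff n k q + q) mod n = k" by (simp only: of_nat_eq_iff)
    show "cdiff n k q \<in> {..<n}" using that by (simp add: cdiff_less)
    have "w ^ (cdiff n k q + q) = w ^ k"
      using power_mod[of "cdiff n k q + q"] inverse by simp
    then show "w ^ (cdiff n k q + q) * u (cdiff n k q) = w ^ k * u (cdiff n k q)" by simp
  next
    fix p assume "p \<in> {..<n}"
    then show "cdiff n ((p + q) mod n) q = p"
      by (simp add: zmod_int mod_diff_left_eq)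
    show "(p + q) mod n \<in> {..<n}" using that by simp
  qed
  have "(\<Sum>k<n. w ^ k * (\<Sum>q<n. u (cdiff n k q) * v q)) =
      (\<Sum>k<n. \<Sum>q<n. (w ^ k * u (cdiff n k q)) * v q)"
    by (simp add: sum_distrib_left mult.assoc)
  also have "\<dots> = (\<Sum>q<n. (\<Sum>k<n. w ^ k * u (cdiff n k q)) * v q)"
    by (subst sum.swap) (simp add: sum_distrib_right)
  also have "\<dots> = (\<Sum>q<n. (\<Sum>p<n. w ^ (p + q) * u p) * v q)"
    by (intro sum.cong refl) (simp add: shift)
  also have "\<dots> = (\<Sum>q<n. (\<Sum>p<n. w ^ p * u p) * (w ^ q * v q))"
    by (simp add: sum_distrib_left sum_distrib_right power_add mult_ac)
  also have "\<dots> = (\<Sum>p<n. w ^ p * u p) * (\<Sum>q<n. w ^ q * v q)"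
    by (rule sum_distrib_left[symmetric])
  finally show ?thesis .
qed

text \<open>
  Each transform contributes a factor \<open>1 / sqrt n\<close>. There is one of them on the left and two in
  the product on the right, so that \<open>sqrt n\<close> remains.
\<close>

lemma dft_circular_convolution:
  fixes u v :: "nat \<Rightarrow> complex"
  assumes "m < n"
  shows "(\<Sum>k<n. dft n $$ (m, k) * (\<Sum>q<n. u (cdiff n k q) * v q)) =
    complex_of_real (sqrt (real n)) * ((\<Sum>p<n. dft n $$ (m, p) * u p) * (\<Sum>q<n. dft n $$ (m, q) * v q))"
proof -
  define w where "w = dft_root n ^ m"
  define c where "c = 1 / complex_of_real (sqrt (real n))"
  have "w ^ n = (dft_root n ^ n) ^ m"
    by (simp add: w_def mult.commute flip: power_mult)
  then have "w ^ n = 1" by (simp add: dft_root_power_self)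
  have scale: "(\<Sum>k<n. dft n $$ (m, k) * f k) = c * (\<Sum>k<n. w ^ k * f k)" for f
    using assms by (simp add: index_dft c_def w_def sum_distrib_left mult.assoc flip: power_mult)
  have "complex_of_real (sqrt (real n)) * c = 1"
    using assms by (simp add: c_def)
  then have "complex_of_real (sqrt (real n)) * ((c * a) * (c * b)) = c * (a * b)" for a b
    by (metis mult.assoc mult.left_commute mult_1)
  then show ?thesis
    by (simp only: scale circular_convolution_power_sum[OF \<open>w ^ n = 1\<close>])
qed

lemma dft_t_product:
  fixes X Y :: "complex tensor3"
  assumes "dim2 X = dim1 Y" "dim3 X = n" "dim3 Y = n"
    and "i < dim1 X" "j < dim2 Y" "m < n"
  shows "((X \<star> Y) \<times>\<^sub>3 dft n) $$$ (i, j, m) = complex_of_real (sqrt (real n)) *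
    (\<Sum>s<dim2 X. (X \<times>\<^sub>3 dft n) $$$ (i, s, m) * (Y \<times>\<^sub>3 dft n) $$$ (s, j, m))"
proof -
  have "((X \<star> Y) \<times>\<^sub>3 dft n) $$$ (i, j, m) = (\<Sum>k<n. dft n $$ (m, k) *
      (\<Sum>q<n. \<Sum>s<dim2 X. X $$$ (i, s, cdiff n k q) * Y $$$ (s, j, q)))"
    using assms by (simp add: index_t_product)
  also have "\<dots> = (\<Sum>k<n. \<Sum>s<dim2 X. dft n $$ (m, k) *
      (\<Sum>q<n. X $$$ (i, s, cdiff n k q) * Y $$$ (s, j, q)))"
    by (subst sum.swap) (simp add: sum_distrib_left)
  also have "\<dots> = (\<Sum>s<dim2 X. \<Sum>k<n. dft n $$ (m, k) *
      (\<Sum>q<n. X $$$ (i, s, cdiff n k q) * Y $$$ (s, j, q)))"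
    by (rule sum.swap)
  also have "\<dots> = (\<Sum>s<dim2 X. complex_of_real (sqrt (real n)) *
      ((\<Sum>p<n. dft n $$ (m, p) * X $$$ (i, s, p)) * (\<Sum>q<n. dft n $$ (m, q) * Y $$$ (s, j, q))))"
    using assms by (intro sum.cong refl) (rule dft_circular_convolution)
  finally show ?thesis
    using assms by (simp add: sum_distrib_left)
qed

section \<open>The Tucker representation of the T-product\<close>

text \<open>
  Only the factors \<open>a s \<alpha>\<close> and \<open>b s \<beta>\<close> contain the contracted index \<open>s\<close>, so the sum over \<open>s\<close> can
  be moved innermost, where it is an entry of the matrix called \<open>M\<close> in the theorem.
\<close>

lemma sum_contracted_index:
  fixes a b g h :: "nat \<Rightarrow> nat \<Rightarrow> 'a :: comm_semiring_0"
  shows "(\<Sum>s<l. (\<Sum>\<alpha>'<A'. x \<alpha>' * (\<Sum>\<alpha><A. a s \<alpha> * g \<alpha> \<alpha>')) * (\<Sum>\<beta>'<B'. y \<beta>' * (\<Sum>\<beta><B. b s \<beta> * h \<beta> \<beta>'))) =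
    (\<Sum>\<alpha><A. \<Sum>\<beta><B. \<Sum>\<alpha>'<A'. \<Sum>\<beta>'<B'. g \<alpha> \<alpha>' * (\<Sum>s<l. a s \<alpha> * b s \<beta>) * h \<beta> \<beta>' * x \<alpha>' * y \<beta>')"
proof -
  let ?x = "\<lambda>\<alpha>. \<Sum>\<alpha>'<A'. x \<alpha>' * g \<alpha> \<alpha>'" and ?y = "\<lambda>\<beta>. \<Sum>\<beta>'<B'. y \<beta>' * h \<beta> \<beta>'"
  have inner: "(\<Sum>\<alpha>'<K'. z \<alpha>' * (\<Sum>\<alpha><K. c \<alpha> * f \<alpha> \<alpha>')) = (\<Sum>\<alpha><K. c \<alpha> * (\<Sum>\<alpha>'<K'. z \<alpha>' * f \<alpha> \<alpha>'))"
    for K K' :: nat and z c :: "nat \<Rightarrow> 'a" and f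
    by (simp add: sum_distrib_left mult.left_commute) (rule sum.swap)
  have "(\<Sum>s<l. (\<Sum>\<alpha>'<A'. x \<alpha>' * (\<Sum>\<alpha><A. a s \<alpha> * g \<alpha> \<alpha>')) * (\<Sum>\<beta>'<B'. y \<beta>' * (\<Sum>\<beta><B. b s \<beta> * h \<beta> \<beta>')))
      = (\<Sum>s<l. \<Sum>\<alpha><A. \<Sum>\<beta><B. (a s \<alpha> * ?x \<alpha>) * (b s \<beta> * ?y \<beta>))"
    unfolding inner[where z = x and f = g] inner[where z = y and f = h] sum_product ..
  also have "\<dots> = (\<Sum>\<alpha><A. \<Sum>s<l. \<Sum>\<beta><B. (a s \<alpha> * ?x \<alpha>) * (b s \<beta> * ?y \<beta>))"
    by (rule sum.swap)
  also have "\<dots> = (\<Sum>\<alpha><A. \<Sum>\<beta><B. \<Sum>s<l. (a s \<alpha> * ?x \<alpha>) * (b s \<beta> * ?y \<beta>))"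
    by (intro sum.cong refl sum.swap)
  also have "\<dots> = (\<Sum>\<alpha><A. \<Sum>\<beta><B. (\<Sum>s<l. a s \<alpha> * b s \<beta>) * (?x \<alpha> * ?y \<beta>))"
    by (simp add: sum_distrib_right mult_ac)
  also have "\<dots> = (\<Sum>\<alpha><A. \<Sum>\<beta><B. \<Sum>\<alpha>'<A'. \<Sum>\<beta>'<B'.
      g \<alpha> \<alpha>' * (\<Sum>s<l. a s \<alpha> * b s \<beta>) * h \<beta> \<beta>' * x \<alpha>' * y \<beta>')"
  proof (intro sum.cong refl)
    fix \<alpha> \<beta>
    have "c * (?x \<alpha> * ?y \<beta>) = (\<Sum>\<alpha>'<A'. \<Sum>\<beta>'<B'. g \<alpha> \<alpha>' * c * h \<beta> \<beta>' * x \<alpha>' * y \<beta>')" for c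
      by (simp only: sum_product) (simp add: sum_distrib_left mult_ac)
    then show "(\<Sum>s<l. a s \<alpha> * b s \<beta>) * (?x \<alpha> * ?y \<beta>) = (\<Sum>\<alpha>'<A'. \<Sum>\<beta>'<B'.
        g \<alpha> \<alpha>' * (\<Sum>s<l. a s \<alpha> * b s \<beta>) * h \<beta> \<beta>' * x \<alpha>' * y \<beta>')" .
  qed
  finally show ?thesis .
qed

theorem proposition3p6:
  fixes \<T> \<S> \<G> \<H> :: "real tensor3"
    and U\<^sub>1 U\<^sub>2 U\<^sub>3 V\<^sub>1 V\<^sub>2 V\<^sub>3 M :: "real mat"
    and Ut\<^sub>3 Vt\<^sub>3 :: "complex mat"
    and Pt :: "complex tensor3"
    and n\<^sub>1 n\<^sub>2 n\<^sub>3 l r\<^sub>1 r\<^sub>2 r\<^sub>3 s\<^sub>1 s\<^sub>2 s\<^sub>3 :: nat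
  assumes "\<T> \<in> carrier_tensor3 n\<^sub>1 l n\<^sub>3" and "\<S> \<in> carrier_tensor3 l n\<^sub>2 n\<^sub>3"
    and "\<G> \<in> carrier_tensor3 r\<^sub>1 r\<^sub>2 r\<^sub>3" and "\<H> \<in> carrier_tensor3 s\<^sub>1 s\<^sub>2 s\<^sub>3"
    and "U\<^sub>1 \<in> carrier_mat n\<^sub>1 r\<^sub>1" and "U\<^sub>2 \<in> carrier_mat l r\<^sub>2" and "U\<^sub>3 \<in> carrier_mat n\<^sub>3 r\<^sub>3"
    and "V\<^sub>1 \<in> carrier_mat l s\<^sub>1" and "V\<^sub>2 \<in> carrier_mat n\<^sub>2 s\<^sub>2" and "V\<^sub>3 \<in> carrier_mat n\<^sub>3 s\<^sub>3"
    and "\<T> = tucker \<G> U\<^sub>1 U\<^sub>2 U\<^sub>3" and "\<S> = tucker \<H> V\<^sub>1 V\<^sub>2 V\<^sub>3"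
    and "M = U\<^sub>2\<^sup>T * V\<^sub>1"
    and "Ut\<^sub>3 = dft n\<^sub>3 * map_mat complex_of_real U\<^sub>3"
    and "Vt\<^sub>3 = dft n\<^sub>3 * map_mat complex_of_real V\<^sub>3"
    and "Pt = tensor3 r\<^sub>1 s\<^sub>2 n\<^sub>3 (\<lambda>(\<alpha>\<^sub>1, \<beta>\<^sub>2, \<gamma>\<^sub>3).
           \<Sum>\<alpha>\<^sub>2<r\<^sub>2. \<Sum>\<beta>\<^sub>1<s\<^sub>1. \<Sum>\<alpha>\<^sub>3<r\<^sub>3. \<Sum>\<beta>\<^sub>3<s\<^sub>3.
             complex_of_real (\<G> $$$ (\<alpha>\<^sub>1, \<alpha>\<^sub>2, \<alpha>\<^sub>3)) * complex_of_real (M $$ (\<alpha>\<^sub>2, \<beta>\<^sub>1))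
             * complex_of_real (\<H> $$$ (\<beta>\<^sub>1, \<beta>\<^sub>2, \<beta>\<^sub>3)) * Ut\<^sub>3 $$ (\<gamma>\<^sub>3, \<alpha>\<^sub>3) * Vt\<^sub>3 $$ (\<gamma>\<^sub>3, \<beta>\<^sub>3))"
  shows "\<T> \<star> \<S> \<in> carrier_tensor3 n\<^sub>1 n\<^sub>2 n\<^sub>3 \<and>
    (\<exists>P \<in> carrier_tensor3 r\<^sub>1 s\<^sub>2 n\<^sub>3.
       map_tensor3 complex_of_real P
         = complex_of_real (sqrt (real n\<^sub>3)) \<cdot>\<^sub>t (Pt \<times>\<^sub>3 the (mat_inverse (dft n\<^sub>3))) \<and>
       \<T> \<star> \<S> = tucker P U\<^sub>1 V\<^sub>2 (1\<^sub>m n\<^sub>3))"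

proof -
  note carriers = assms(1-10)
  have dims [simp]:
    "dim1 \<G> = r\<^sub>1" "dim2 \<G> = r\<^sub>2" "dim3 \<G> = r\<^sub>3" "dim1 \<H> = s\<^sub>1" "dim2 \<H> = s\<^sub>2" "dim3 \<H> = s\<^sub>3"
    "dim_row U\<^sub>1 = n\<^sub>1" "dim_row U\<^sub>2 = l" "dim_row U\<^sub>3 = n\<^sub>3"
    "dim_col U\<^sub>1 = r\<^sub>1" "dim_col U\<^sub>2 = r\<^sub>2" "dim_col U\<^sub>3 = r\<^sub>3"
    "dim_row V\<^sub>1 = l" "dim_row V\<^sub>2 = n\<^sub>2" "dim_row V\<^sub>3 = n\<^sub>3"
    "dim_col V\<^sub>1 = s\<^sub>1" "dim_col V\<^sub>2 = s\<^sub>2" "dim_col V\<^sub>3 = s\<^sub>3"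
    using carriers by (auto simp: carrier_tensor3_def)
  let ?c = "map_tensor3 complex_of_real" and ?m = "map_mat complex_of_real"
  let ?F = "dft n\<^sub>3" and ?r = "complex_of_real (sqrt (real n\<^sub>3))"
  \<comment> \<open>Left out of \<open>L\<close> and \<open>R\<close> are exactly the two factors that remain factors of the product.\<close>
  define L where "L = \<G> \<times>\<^sub>2 U\<^sub>2 \<times>\<^sub>3 U\<^sub>3"
  define R where "R = \<H> \<times>\<^sub>1 V\<^sub>1 \<times>\<^sub>3 V\<^sub>3"
  define P where "P = L \<star> R"
  have LR [simp]: "dim1 L = r\<^sub>1" "dim2 L = l" "dim3 L = n\<^sub>3" "dim1 R = l" "dim2 R = s\<^sub>2" "dim3 R = n\<^sub>3"
    by (simp_all add: L_def R_def)
  have P [simp]: "dim1 P = r\<^sub>1" "dim2 P = s\<^sub>2" "dim3 P = n\<^sub>3"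
    by (simp_all add: P_def)

  have "\<T> = L \<times>\<^sub>1 U\<^sub>1"
    by (simp only: assms(11) tucker_def L_def mode1_mode2_commute mode1_mode3_commute)
  moreover have "\<S> = R \<times>\<^sub>2 V\<^sub>2"
    by (simp only: assms(12) tucker_def R_def mode2_mode3_commute)
  ultimately have "\<T> \<star> \<S> = P \<times>\<^sub>1 U\<^sub>1 \<times>\<^sub>2 V\<^sub>2"
    by (simp add: mode1_t_product t_product_mode2 P_def)
  then have product: "\<T> \<star> \<S> = tucker P U\<^sub>1 V\<^sub>2 (1\<^sub>m n\<^sub>3)"
    using mode3_mult_one[of "P \<times>\<^sub>1 U\<^sub>1 \<times>\<^sub>2 V\<^sub>2"] by (simp add: tucker_def)

  have cP: "?c P = ?c L \<star> ?c R"
    by (simp add: P_def map_tensor3_of_real_t_product)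
  have L_hat: "?c L \<times>\<^sub>3 ?F = ?c \<G> \<times>\<^sub>2 ?m U\<^sub>2 \<times>\<^sub>3 Ut\<^sub>3"
    by (simp add: L_def map_tensor3_of_real_mode2 map_tensor3_of_real_mode3 mode3_mult_mult assms(14))
  have R_hat: "?c R \<times>\<^sub>3 ?F = ?c \<H> \<times>\<^sub>1 ?m V\<^sub>1 \<times>\<^sub>3 Vt\<^sub>3"
    by (simp add: R_def map_tensor3_of_real_mode1 map_tensor3_of_real_mode3 mode3_mult_mult assms(15))
  have hat_dims [simp]: "dim_row Ut\<^sub>3 = n\<^sub>3" "dim_row Vt\<^sub>3 = n\<^sub>3"
    by (simp_all add: assms(14,15))
  have M: "complex_of_real (M $$ (\<alpha>, \<beta>)) =
      (\<Sum>s<l. complex_of_real (U\<^sub>2 $$ (s, \<alpha>)) * complex_of_real (V\<^sub>1 $$ (s, \<beta>)))"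
    if "\<alpha> < r\<^sub>2" "\<beta> < s\<^sub>1" for \<alpha> \<beta>
    using that by (simp add: assms(13) index_mult_mat_sum del: index_mult_mat(1))
  have transform: "?c P \<times>\<^sub>3 ?F = ?r \<cdot>\<^sub>t Pt"
  proof (rule tensor3_eqI)
    fix i j m
    assume "i < dim1 (?r \<cdot>\<^sub>t Pt)" "j < dim2 (?r \<cdot>\<^sub>t Pt)" "m < dim3 (?r \<cdot>\<^sub>t Pt)"
    then have ijm: "i < r\<^sub>1" "j < s\<^sub>2" "m < n\<^sub>3"
      by (simp_all add: assms(16))
    have "(?c P \<times>\<^sub>3 ?F) $$$ (i, j, m) =
        ?r * (\<Sum>s<l. (?c L \<times>\<^sub>3 ?F) $$$ (i, s, m) * (?c R \<times>\<^sub>3 ?F) $$$ (s, j, m))"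
      unfolding cP using ijm by (subst dft_t_product) (simp_all del: index_mode3_mult)
    also have "(\<Sum>s<l. (?c L \<times>\<^sub>3 ?F) $$$ (i, s, m) * (?c R \<times>\<^sub>3 ?F) $$$ (s, j, m)) =
        (\<Sum>s<l.
          (\<Sum>\<alpha>'<r\<^sub>3. Ut\<^sub>3 $$ (m, \<alpha>') *
            (\<Sum>\<alpha><r\<^sub>2. complex_of_real (U\<^sub>2 $$ (s, \<alpha>)) * complex_of_real (\<G> $$$ (i, \<alpha>, \<alpha>')))) *
          (\<Sum>\<beta>'<s\<^sub>3. Vt\<^sub>3 $$ (m, \<beta>') *
            (\<Sum>\<beta><s\<^sub>1. complex_of_real (V\<^sub>1 $$ (s, \<beta>)) * complex_of_real (\<H> $$$ (\<beta>, j, \<beta>')))))"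
      unfolding L_hat R_hat using ijm by simp
    also have "\<dots> = Pt $$$ (i, j, m)"
      using ijm by (simp add: sum_contracted_index assms(16) M)
    finally show "(?c P \<times>\<^sub>3 ?F) $$$ (i, j, m) = (?r \<cdot>\<^sub>t Pt) $$$ (i, j, m)"
      using ijm by (simp add: assms(16))
  qed (simp_all add: assms(16))

  let ?I = "the (mat_inverse ?F)"
  have I: "?I \<in> carrier_mat n\<^sub>3 n\<^sub>3" "?I * ?F = 1\<^sub>m n\<^sub>3"
    using mat_inverse_dft by blast+
  have "?r \<cdot>\<^sub>t (Pt \<times>\<^sub>3 ?I) = ?c P \<times>\<^sub>3 ?F \<times>\<^sub>3 ?I"
    by (simp only: smult_mode3_mult transform)
  also have "\<dots> = ?c P \<times>\<^sub>3 (?I * ?F)"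
    using I(1) by (intro mode3_mult_mult) auto
  also have "\<dots> = ?c P"
    using mode3_mult_one[of "?c P"] by (simp add: I(2))
  finally have core: "?c P = ?r \<cdot>\<^sub>t (Pt \<times>\<^sub>3 ?I)" ..

  have "\<T> \<star> \<S> \<in> carrier_tensor3 n\<^sub>1 n\<^sub>2 n\<^sub>3"
    using carriers by (simp add: carrier_tensor3_def)
  moreover have "P \<in> carrier_tensor3 r\<^sub>1 s\<^sub>2 n\<^sub>3"
    by (simp add: carrier_tensor3_def)
  ultimately show ?thesis
    using core product by blast
qed

end
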